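(* Let $\mathcal{L}=(L,\leq)$ be a finite congruence-uniform lattice. Then $\mathcal{L}$ is distributive if and only if the core label order $\mathrm{CLO}(\mathcal{L})$ is the face poset of the canonical join complex $\mathrm{Can}(\mathcal{L})$, i.e. if and only if $\bigl(\{\Psi(x)\mid x\in L\},\subseteq\bigr)$ equals $\bigl(\{\Gamma(x)\mid x\in L\},\subseteq\bigr)$.
   Context: A finite lattice is congruence uniform if it can be obtained from the one-element lattice by a finite sequence of interval doublings (A. Day); here the doubling of a poset $\mathcal{P}=(P,\leq)$ by $X\subseteq P$ is the subposet of $\mathcal{P}\times\{0<1\}$ with ground set $(P_{\leq X}\times\{0\})\uplus(((P\setminus P_{\leq X})\cup X)\times\{1\})$, where $P_{\leq X}=\{y\in P\mid y\le x \text{ for some } x\in X\}$. Congruence-uniform lattices are semidistributive. An element $j$ is join-irreducible if $j=x\vee y$ implies $j\in\{x,y\}$; in a finite lattice such $j$ has a unique lower cover $j_*$; $\mathcal{J}(\mathcal{L})$ denotes the set of join-irreducibles. Two cover relations $x\lessdot y$ and $u\lessdot v$ are perspective if either ($v\vee x=y$ and $v\wedge x=u$) or ($u\vee y=v$ and $u\wedge y=x$). In a finite congruence-uniform lattice, for each cover relation $x\lessdot y$ there is a unique $j\in\mathcal{J}(\mathcal{L})$ with $(x,y)$ and $(j_*,j)$ perspective; write $\gamma(x,y)=j$. A join representation of $x$ is a set $X$ with $\bigvee X=x$; it is canonical if for every join representation $Y$ of $x$, every element of $X$ lies below some element of $Y$. In a finite semidistributive lattice every $x$ has a canonical join representation $\Gamma(x)$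 (for congruence-uniform lattices, $\Gamma(x)=\{\gamma(y,x)\mid y\lessdot x\}$). The canonical join complex $\mathrm{Can}(\mathcal{L})$ is the simplicial complex whose faces are the sets $\Gamma(x)$, $x\in L$; its face poset is the set of faces ordered by inclusion. The nucleus of $x$ is $x_\downarrow=\bigwedge_{y\lessdot x} y$ (with $x_\downarrow=x$ if $x$ has no lower covers), and the core label set is $\Psi(x)=\{\gamma(u,v)\mid x_\downarrow\le u\lessdot v\le x\}$. The core label order $\mathrm{CLO}(\mathcal{L})$ is $L$ ordered by $x\sqsubseteq y$ iff $\Psi(x)\subseteq\Psi(y)$, identified with the poset $(\{\Psi(x)\mid x\in L\},\subseteq)$. *)

theory Defs
  imports Main
begin

section \<open>Congruence-uniform posets\<close>

text \<open>A poset is given by its reflexive order relation \<open>r\<close>; the ground set is \<open>Field r\<close>.\<close>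

definition poset_iso :: "'a rel \<Rightarrow> 'b rel \<Rightarrow> bool" where
  "poset_iso r s \<longleftrightarrow>
    (\<exists>f. bij_betw f (Field r) (Field s) \<and>
      (\<forall>x\<in>Field r. \<forall>y\<in>Field r. (x, y) \<in> r \<longleftrightarrow> (f x, f y) \<in> s))"

definition down_set :: "'a rel \<Rightarrow> 'a set \<Rightarrow> 'a set" where
  "down_set r X = {y \<in> Field r. \<exists>x\<in>X. (y, x) \<in> r}"

definition interval :: "'a rel \<Rightarrow> 'a \<Rightarrow> 'a \<Rightarrow> 'a set" where
  "interval r a b = {z. (a, z) \<in> r \<and> (z, b) \<in> r}"

text \<open>The two-element chain is \<^typ>\<open>bool\<close>, with \<open>False < True\<close>.\<close>

definition doubling :: "'a rel \<Rightarrow> 'a set \<Rightarrow> ('a \<times> bool) rel" where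
  "doubling r X =
    relation_of (\<lambda>(p, i) (q, j). (p, q) \<in> r \<and> i \<le> j)
      (down_set r X \<times> {False} \<union> ((Field r - down_set r X) \<union> X) \<times> {True})"

text \<open>A doubling changes the type of the ground set. Every poset occurring in a finite
  sequence of doublings is finite, so it is represented by an isomorphic copy on natural
  numbers.\<close>

inductive iterated_interval_doubling :: "nat rel \<Rightarrow> bool" where
  one_element: "iterated_interval_doubling {(n, n)}"
| double: "iterated_interval_doubling r \<Longrightarrow> (a, b) \<in> r \<Longrightarrow>
    poset_iso (doubling r (interval r a b)) s \<Longrightarrow> iterated_interval_doubling s"

definition congruence_uniform :: "'a rel \<Rightarrow> bool" where
  "congruence_uniform r \<longleftrightarrow> (\<exists>s. iterated_interval_doubling s \<and> poset_iso r s)"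


section \<open>Labels in finite lattices\<close>

text \<open>A finite lattice is a type of sort \<open>{finite, complete_lattice}\<close>: every nonempty finite
  lattice is complete, and its \<^const>\<open>Sup\<close>, \<^const>\<open>Inf\<close>, \<^const>\<open>bot\<close>, \<^const>\<open>top\<close> are
  determined by the order.\<close>

definition covered_by :: "'a::order \<Rightarrow> 'a \<Rightarrow> bool" (infix \<open>\<lessdot>\<close> 50) where
  "x \<lessdot> y \<longleftrightarrow> x < y \<and> \<not> (\<exists>z. x < z \<and> z < y)"

text \<open>The condition \<open>j \<noteq> bot\<close> is needed for the existence of the lower cover of \<open>j\<close>.\<close>

definition join_irreducible :: "'a::{finite, complete_lattice} \<Rightarrow> bool" where
  "join_irreducible j \<longleftrightarrow> j \<noteq> bot \<and> (\<forall>x y. j = sup x y \<longrightarrow> j \<in> {x, y})"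

definition lower_cover :: "'a::{finite, complete_lattice} \<Rightarrow> 'a" where
  "lower_cover j = (THE i. i \<lessdot> j)"

text \<open>Perspectivity of the cover relations \<open>x \<lessdot> y\<close> and \<open>u \<lessdot> v\<close>.\<close>

definition perspective :: "'a::lattice \<times> 'a \<Rightarrow> 'a \<times> 'a \<Rightarrow> bool" where
  "perspective = (\<lambda>(x, y) (u, v).
    (sup v x = y \<and> inf v x = u) \<or> (sup u y = v \<and> inf u y = x))"

definition cover_label :: "'a::{finite, complete_lattice} \<Rightarrow> 'a \<Rightarrow> 'a" where
  "cover_label x y = (THE j. join_irreducible j \<and> perspective (x, y) (lower_cover j, j))"

definition nucleus :: "'a::{finite, complete_lattice} \<Rightarrow> 'a" where
  "nucleus x = (if \<exists>y. y \<lessdot> x then Inf {y. y \<lessdot> x} else x)"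

definition core_label_set :: "'a::{finite, complete_lattice} \<Rightarrow> 'a set" where
  "core_label_set x = {cover_label u v | u v. nucleus x \<le> u \<and> u \<lessdot> v \<and> v \<le> x}"

definition core_label_order :: "'a::{finite, complete_lattice} set rel" where
  "core_label_order = relation_of (\<subseteq>) (range core_label_set)"


section \<open>The canonical join complex\<close>

definition join_representation :: "'a::{finite, complete_lattice} set \<Rightarrow> 'a \<Rightarrow> bool" where
  "join_representation X x \<longleftrightarrow> Sup X = x"

text \<open>Without irredundancy the refinement condition does not determine \<open>X\<close>: adding to a
  canonical join representation any element below one of its members preserves it.\<close>

definition canonical_join_representation ::
    "'a::{finite, complete_lattice} set \<Rightarrow> 'a \<Rightarrow> bool" where
  "canonical_join_representation X x \<longleftrightarrow>
    join_representation X x \<and>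
    (\<forall>Z. Z \<subset> X \<longrightarrow> \<not> join_representation Z x) \<and>
    (\<forall>Y. join_representation Y x \<longrightarrow> (\<forall>a\<in>X. \<exists>b\<in>Y. a \<le> b))"

definition canonical_joinands :: "'a::{finite, complete_lattice} \<Rightarrow> 'a set" where
  "canonical_joinands x = (THE X. canonical_join_representation X x)"

definition canonical_join_complex :: "'a::{finite, complete_lattice} set set" where
  "canonical_join_complex = range canonical_joinands"

definition face_poset :: "'a set set \<Rightarrow> 'a set rel" where
  "face_poset \<Delta> = relation_of (\<subseteq>) \<Delta>"

end

theory Submission
  imports Defs
begin

text \<open>Interval doubling preserves being a semidistributive lattice, so a congruence-uniform
  lattice is semidistributive. In a join-semidistributive lattice the label of \<open>x \<lessdot> y\<close> is the
  least \<open>z\<close> with \<open>x \<squnion> z = y\<close>, and the canonical joinands of \<open>x\<close> are the labels of the covers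
  below \<open>x\<close>.

  If the lattice is distributive, a label \<open>j\<close> in the core of \<open>x\<close> satisfies \<open>j \<squnion> y = x\<close> for some
  \<open>y \<lessdot> x\<close>, and distributivity turns \<open>j\<close> into the label of \<open>y \<lessdot> x\<close>; hence \<open>\<Psi> x = \<Gamma> x\<close>.

  Conversely both \<open>\<Psi> x\<close> and \<open>\<Gamma> x\<close> have join \<open>x\<close>, so if the two families agree then
  \<open>\<Psi> x = \<Gamma> x\<close> for all \<open>x\<close>. Two lower covers \<open>u\<close>, \<open>y\<close> of \<open>x\<close> then span a diamond whose opposite
  sides carry the same labels, and by descending along such diamonds \<open>\<gamma>(u, v)\<close> is the only
  join-irreducible below \<open>v\<close> but not below \<open>u\<close>. With meet-semidistributivity this makes every
  join-irreducible join-prime, so the lattice is distributive.\<close>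

section \<open>Semidistributivity of interval doublings\<close>

text \<open>Meet-semidistributivity is stated without operations: \<open>a \<sqinter> b = a \<sqinter> c\<close> says that \<open>b\<close> and \<open>c\<close>
  bound the same elements below \<open>a\<close>, and then some upper bound \<open>d\<close> of \<open>b\<close>, \<open>c\<close> has
  \<open>a \<sqinter> d \<le> b\<close>. All quantifiers are bounded by the ground set, which makes these
  notions visibly invariant under isomorphism.\<close>

definition has_meets :: "'a rel \<Rightarrow> bool" where
  "has_meets r \<longleftrightarrow> (\<forall>x\<in>Field r. \<forall>y\<in>Field r. \<exists>w\<in>Field r. \<forall>z\<in>Field r.
    (z, w) \<in> r \<longleftrightarrow> (z, x) \<in> r \<and> (z, y) \<in> r)"

definition has_joins :: "'a rel \<Rightarrow> bool" where
  "has_joins r \<longleftrightarrow> (\<forall>x\<in>Field r. \<forall>y\<in>Field r. \<exists>w\<in>Field r. \<forall>z\<in>Field r.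
    (w, z) \<in> r \<longleftrightarrow> (x, z) \<in> r \<and> (y, z) \<in> r)"

definition meet_sd :: "'a rel \<Rightarrow> bool" where
  "meet_sd r \<longleftrightarrow> (\<forall>a\<in>Field r. \<forall>b\<in>Field r. \<forall>c\<in>Field r.
    (\<forall>z\<in>Field r. (z, a) \<in> r \<longrightarrow> ((z, b) \<in> r \<longleftrightarrow> (z, c) \<in> r)) \<longrightarrow>
    (\<exists>d\<in>Field r. (b, d) \<in> r \<and> (c, d) \<in> r \<and>
      (\<forall>z\<in>Field r. (z, a) \<in> r \<and> (z, d) \<in> r \<longrightarrow> (z, b) \<in> r)))"

definition join_sd :: "'a rel \<Rightarrow> bool" where
  "join_sd r \<longleftrightarrow> (\<forall>a\<in>Field r. \<forall>b\<in>Field r. \<forall>c\<in>Field r.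
    (\<forall>z\<in>Field r. (a, z) \<in> r \<longrightarrow> ((b, z) \<in> r \<longleftrightarrow> (c, z) \<in> r)) \<longrightarrow>
    (\<exists>d\<in>Field r. (d, b) \<in> r \<and> (d, c) \<in> r \<and>
      (\<forall>z\<in>Field r. (a, z) \<in> r \<and> (d, z) \<in> r \<longrightarrow> (b, z) \<in> r)))"

definition sd_lattice :: "'a rel \<Rightarrow> bool" where
  "sd_lattice r \<longleftrightarrow>
    (\<forall>x\<in>Field r. (x, x) \<in> r) \<and>
    (\<forall>x\<in>Field r. \<forall>y\<in>Field r. \<forall>z\<in>Field r. (x, y) \<in> r \<longrightarrow> (y, z) \<in> r \<longrightarrow> (x, z) \<in> r) \<and>
    has_meets r \<and> has_joins r \<and> meet_sd r \<and> join_sd r"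

lemma sd_lattice_iso:
  assumes "poset_iso r s"
  shows "sd_lattice r \<longleftrightarrow> sd_lattice s"
proof -
  obtain f where f: "bij_betw f (Field r) (Field s)"
    and r: "\<And>x y. x \<in> Field r \<Longrightarrow> y \<in> Field r \<Longrightarrow> (f x, f y) \<in> s \<longleftrightarrow> (x, y) \<in> r"
    using assms unfolding poset_iso_def by blast
  have F: "Field s = f ` Field r"
    using f by (simp add: bij_betw_def)
  show ?thesis
    unfolding sd_lattice_def has_meets_def has_joins_def meet_sd_def join_sd_def F
    by (simp add: r cong: ball_cong bex_cong)
qed

text \<open>Meets and joins of the doubling lie over those of \<open>r\<close>; only the second
  component has to be chosen. For semidistributivity the actual join (or meet) \<open>w\<close> of
  the two elements serves as bound: its first component is controlled by the witness
  \<open>d\<close> from \<open>r\<close>, and a clash of second components is refuted by an end of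
  the interval.\<close>

lemma sd_lattice_doubling:
  assumes sd: "sd_lattice r" and ab: "(a, b) \<in> r"
  shows "sd_lattice (doubling r (interval r a b))"
proof -
  let ?F = "Field r" and ?D = "doubling r (interval r a b)"
  have refl: "\<And>x. x \<in> ?F \<Longrightarrow> (x, x) \<in> r"
    using sd unfolding sd_lattice_def by blast
  have trans: "\<And>x y z. (x, y) \<in> r \<Longrightarrow> (y, z) \<in> r \<Longrightarrow> (x, z) \<in> r"
  proof -
    fix x y z assume "(x, y) \<in> r" "(y, z) \<in> r"
    moreover from this have "x \<in> ?F" "y \<in> ?F" "z \<in> ?F"
      by (auto intro: FieldI1 FieldI2)
    ultimately show "(x, z) \<in> r" using sd unfolding sd_lattice_def by blast
  qed
  have aF: "a \<in> ?F" and bF: "b \<in> ?F"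
    using ab by (auto intro: FieldI1 FieldI2)
  \<comment> \<open>The ground set of the doubling, read pointwise: \<open>p\<close> occurs at level
    \<open>False\<close> iff it is below \<open>b\<close>, and at level \<open>True\<close> iff it
    is not below \<open>b\<close> or is above \<open>a\<close>.\<close>
  define G where
    "G = {(p, i). p \<in> ?F \<and> (if i then (p, b) \<notin> r \<or> (a, p) \<in> r else (p, b) \<in> r)}"
  have G_iff: "(p, i) \<in> G \<longleftrightarrow> p \<in> ?F \<and> (i \<longrightarrow> (p, b) \<notin> r \<or> (a, p) \<in> r) \<and> (\<not> i \<longrightarrow> (p, b) \<in> r)"
    for p i
    by (simp add: G_def)
  have down: "down_set r (interval r a b) = {p \<in> ?F. (p, b) \<in> r}"
    using ab refl[OF bF] trans[of _ _ b] unfolding down_set_def interval_def by blast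
  have G: "down_set r (interval r a b) \<times> {False} \<union>
      ((?F - down_set r (interval r a b)) \<union> interval r a b) \<times> {True} = G"
    unfolding down G_def using FieldI2 by (fastforce simp: interval_def split: if_splits)
  have D: "(u, v) \<in> ?D \<longleftrightarrow> u \<in> G \<and> v \<in> G \<and> (fst u, fst v) \<in> r \<and> (snd u \<longrightarrow> snd v)" for u v
    unfolding doubling_def G relation_of_def by (auto simp: case_prod_unfold le_bool_def)
  have D_pair: "((p, i), (q, j)) \<in> ?D \<longleftrightarrow>
      (p, i) \<in> G \<and> (q, j) \<in> G \<and> (p, q) \<in> r \<and> (i \<longrightarrow> j)" for p i q j
    by (simp add: D)
  have FD: "Field ?D = G"
  proof -
    have "u \<in> G \<Longrightarrow> (u, u) \<in> ?D" for u
      unfolding D using refl by (auto simp: G_def)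
    moreover have "u \<in> G" "v \<in> G" if "(u, v) \<in> ?D" for u v
      using that unfolding D by auto
    ultimately show ?thesis
      unfolding Field_def by blast
  qed
  have meets: "\<exists>w\<in>?F. \<forall>z\<in>?F. (z, w) \<in> r \<longleftrightarrow> (z, x) \<in> r \<and> (z, y) \<in> r"
    if "x \<in> ?F" "y \<in> ?F" for x y
    using sd that unfolding sd_lattice_def has_meets_def by blast
  have joins: "\<exists>w\<in>?F. \<forall>z\<in>?F. (w, z) \<in> r \<longleftrightarrow> (x, z) \<in> r \<and> (y, z) \<in> r"
    if "x \<in> ?F" "y \<in> ?F" for x y
    using sd that unfolding sd_lattice_def has_joins_def by blast
  have has_meets: "has_meets ?D"
    unfolding has_meets_def FD
  proof (intro ballI)
    fix u v assume uv: "u \<in> G" "v \<in> G"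
    obtain p i where u: "u = (p, i)" by (cases u)
    obtain q j where v: "v = (q, j)" by (cases v)
    have F: "p \<in> ?F" "q \<in> ?F" using uv by (auto simp: u v G_def)
    obtain m where m: "m \<in> ?F" and mz: "\<And>z. z \<in> ?F \<Longrightarrow> (z, m) \<in> r \<longleftrightarrow> (z, p) \<in> r \<and> (z, q) \<in> r"
      using meets[OF F] by blast
    have mm: "(m, p) \<in> r" "(m, q) \<in> r" using mz[OF m] refl[OF m] by auto
    \<comment> \<open>The largest level available to the meet: \<open>True\<close> is forced when
      \<open>m\<close> is not below \<open>b\<close>, and otherwise is possible only if
      \<open>a\<close> is below \<open>m\<close> and both arguments are at
      \<open>True\<close>.\<close>
    define k where "k \<longleftrightarrow> (m, b) \<notin> r \<or> ((a, m) \<in> r \<and> i \<and> j)"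
    have k: "k \<longrightarrow> i \<and> j"
      using uv trans[OF mm(1), of b] trans[OF mm(2), of b] unfolding u v G_iff k_def by blast
    have mk: "(m, k) \<in> G" using m unfolding G_iff k_def by blast
    have "(z, (m, k)) \<in> ?D \<longleftrightarrow> (z, u) \<in> ?D \<and> (z, v) \<in> ?D" if zG: "z \<in> G" for z
    proof -
      obtain x l where z: "z = (x, l)" by (cases z)
      have xF: "x \<in> ?F" using zG unfolding z G_iff by blast
      have "l \<and> i \<and> j \<and> (x, m) \<in> r \<longrightarrow> k"
        using zG trans[of x m b] trans[of a x m] unfolding z G_iff k_def by blast
      then show ?thesis
        using zG uv mk mz[OF xF] k unfolding z u v D_pair by blast
    qed
    then show "\<exists>w\<in>G. \<forall>z\<in>G. (z, w) \<in> ?D \<longleftrightarrow> (z, u) \<in> ?D \<and> (z, v) \<in> ?D"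
      using mk by (intro bexI[of _ "(m, k)"] ballI)
  qed
  have has_joins: "has_joins ?D"
    unfolding has_joins_def FD
  proof (intro ballI)
    fix u v assume uv: "u \<in> G" "v \<in> G"
    obtain p i where u: "u = (p, i)" by (cases u)
    obtain q j where v: "v = (q, j)" by (cases v)
    have F: "p \<in> ?F" "q \<in> ?F" using uv by (auto simp: u v G_def)
    obtain m where m: "m \<in> ?F" and mz: "\<And>z. z \<in> ?F \<Longrightarrow> (m, z) \<in> r \<longleftrightarrow> (p, z) \<in> r \<and> (q, z) \<in> r"
      using joins[OF F] by blast
    have mm: "(p, m) \<in> r" "(q, m) \<in> r" using mz[OF m] refl[OF m] by auto
    \<comment> \<open>The smallest level available to the join. If \<open>m\<close> is below
      \<open>b\<close> and, say, \<open>i\<close> holds, then \<open>p\<close> is below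
      \<open>b\<close>, so \<open>a\<close> is below \<open>p\<close> and hence below
      \<open>m\<close>.\<close>
    define k where "k \<longleftrightarrow> (m, b) \<notin> r \<or> i \<or> j"
    have mk: "(m, k) \<in> G"
      using m uv trans[OF mm(1), of b] trans[OF mm(2), of b] trans[OF _ mm(1), of a]
        trans[OF _ mm(2), of a]
      unfolding u v G_iff k_def by blast
    have "((m, k), z) \<in> ?D \<longleftrightarrow> (u, z) \<in> ?D \<and> (v, z) \<in> ?D" if zG: "z \<in> G" for z
    proof -
      obtain x l where z: "z = (x, l)" by (cases z)
      have xF: "x \<in> ?F" using zG unfolding z G_iff by blast
      have "(m, x) \<in> r \<and> (m, b) \<notin> r \<longrightarrow> l"
        using zG trans[of m x b] unfolding z G_iff by blast
      then show ?thesis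
        using zG uv mk mz[OF xF] unfolding z u v D_pair k_def by blast
    qed
    then show "\<exists>w\<in>G. \<forall>z\<in>G. (w, z) \<in> ?D \<longleftrightarrow> (u, z) \<in> ?D \<and> (v, z) \<in> ?D"
      using mk by (intro bexI[of _ "(m, k)"] ballI)
  qed
  have meet_sd: "meet_sd ?D"
    unfolding meet_sd_def FD
  proof (intro ballI impI)
    fix t u v assume tuv: "t \<in> G" "u \<in> G" "v \<in> G"
      and H: "\<forall>z\<in>G. (z, t) \<in> ?D \<longrightarrow> ((z, u) \<in> ?D \<longleftrightarrow> (z, v) \<in> ?D)"
    obtain o' h where t: "t = (o', h)" by (cases t)
    obtain p i where u: "u = (p, i)" by (cases u)
    obtain q j where v: "v = (q, j)" by (cases v)
    have F: "o' \<in> ?F" "p \<in> ?F" "q \<in> ?F" using tuv by (auto simp: t u v G_def)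
    have base: "(z, p) \<in> r \<longleftrightarrow> (z, q) \<in> r" if z: "z \<in> ?F" "(z, o') \<in> r" for z
    proof -
      \<comment> \<open>The lowest copy of \<open>z\<close>: comparing it with elements above it
        only tests first components, so \<open>H\<close> projects to \<open>r\<close>.\<close>
      let ?z = "(z, (z, b) \<notin> r)"
      have zG: "?z \<in> G" using z unfolding G_iff by blast
      have iff: "(?z, (x, l)) \<in> ?D \<longleftrightarrow> (z, x) \<in> r" if "(x, l) \<in> G" for x l
        using zG that trans[of z x b] unfolding D_pair G_iff by blast
      show ?thesis
        using H zG tuv z(2) iff[of o' h] iff[of p i] iff[of q j] unfolding t u v by blast
    qed
    obtain d where d: "d \<in> ?F" "(p, d) \<in> r" "(q, d) \<in> r"
      "\<And>z. z \<in> ?F \<Longrightarrow> (z, o') \<in> r \<Longrightarrow> (z, d) \<in> r \<Longrightarrow> (z, p) \<in> r"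
    proof -
      have "meet_sd r" using sd unfolding sd_lattice_def by blast
      note this[unfolded meet_sd_def, rule_format, OF F base]
      then show thesis using that by blast
    qed
    obtain w where w: "w \<in> G" "\<forall>z\<in>G. (w, z) \<in> ?D \<longleftrightarrow> (u, z) \<in> ?D \<and> (v, z) \<in> ?D"
      using has_joins[unfolded has_joins_def FD, rule_format, OF tuv(2,3)] by blast
    have self: "\<And>z. z \<in> G \<Longrightarrow> (z, z) \<in> ?D"
      unfolding D using refl by (auto simp: G_def)
    have uw: "(u, w) \<in> ?D" "(v, w) \<in> ?D" using w(2)[rule_format, OF w(1)] self[OF w(1)] by blast+
    have wd: "(fst w, d) \<in> r"
    proof -
      \<comment> \<open>The highest copy of \<open>d\<close>, so that it bounds both
        \<open>u\<close> and \<open>v\<close> whatever their levels.\<close>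
      let ?d = "(d, (d, b) \<notin> r \<or> (a, d) \<in> r)"
      have dG: "?d \<in> G" using d(1) unfolding G_iff by blast
      then have "(u, ?d) \<in> ?D \<and> (v, ?d) \<in> ?D"
        using d(2,3) tuv trans[OF d(2), of b] trans[OF d(3), of b] trans[OF _ d(2), of a]
          trans[OF _ d(3), of a]
        unfolding D_pair u v G_iff by blast
      then have "(w, ?d) \<in> ?D" using w dG by simp
      then show ?thesis unfolding D by simp
    qed
    have "(z, u) \<in> ?D" if z: "z \<in> G" "(z, t) \<in> ?D" "(z, w) \<in> ?D" for z
    proof -
      obtain x l where x: "z = (x, l)" by (cases z)
      have xF: "x \<in> ?F" "(x, o') \<in> r" "l \<longrightarrow> h"
        using z unfolding x t D_pair G_iff by blast+
      have "(x, fst w) \<in> r" using z(3) by (simp add: x D)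
      then have xp: "(x, p) \<in> r" by (intro d(4) xF trans[OF _ wd])
      \<comment> \<open>Otherwise \<open>H\<close> forces \<open>v\<close> to level
        \<open>False\<close> as well. Then \<open>(b, False)\<close> bounds \<open>u\<close> and
        \<open>v\<close>, hence \<open>w\<close>, although \<open>w\<close> lies above
        \<open>z\<close>, which is at level \<open>True\<close>.\<close>
      have i if l
      proof (rule ccontr)
        assume "\<not> i"
        then have "(p, b) \<in> r" using tuv(2) unfolding u G_iff by blast
        have "(z, v) \<notin> ?D"
          using H[rule_format, OF z(1,2)] \<open>l\<close> \<open>\<not> i\<close> by (simp add: x u D_pair)
        then have "\<not> j"
          using z(1) xp base[OF xF(1,2)] tuv(3) unfolding x v D_pair by blast
        then have "(q, b) \<in> r" using tuv(3) unfolding v G_iff by blast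
        have "(b, False) \<in> G" using refl[OF bF] bF by (simp add: G_iff)
        then have "(w, (b, False)) \<in> ?D"
          using w(2) tuv \<open>(p, b) \<in> r\<close> \<open>(q, b) \<in> r\<close> \<open>\<not> i\<close> \<open>\<not> j\<close> unfolding u v
          by (simp add: D_pair)
        then show False using z(3) \<open>l\<close> by (simp add: D x)
      qed
      then show ?thesis using xp z(1) tuv(2) unfolding x u D_pair by blast
    qed
    then show "\<exists>d\<in>G. (u, d) \<in> ?D \<and> (v, d) \<in> ?D \<and>
        (\<forall>z\<in>G. (z, t) \<in> ?D \<and> (z, d) \<in> ?D \<longrightarrow> (z, u) \<in> ?D)"
      using w(1) uw by blast
  qed
  have join_sd: "join_sd ?D"
    unfolding join_sd_def FD
  proof (intro ballI impI)
    fix t u v assume tuv: "t \<in> G" "u \<in> G" "v \<in> G"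
      and H: "\<forall>z\<in>G. (t, z) \<in> ?D \<longrightarrow> ((u, z) \<in> ?D \<longleftrightarrow> (v, z) \<in> ?D)"
    obtain o' h where t: "t = (o', h)" by (cases t)
    obtain p i where u: "u = (p, i)" by (cases u)
    obtain q j where v: "v = (q, j)" by (cases v)
    have F: "o' \<in> ?F" "p \<in> ?F" "q \<in> ?F" using tuv by (auto simp: t u v G_def)
    have base: "(p, z) \<in> r \<longleftrightarrow> (q, z) \<in> r" if z: "z \<in> ?F" "(o', z) \<in> r" for z
    proof -
      let ?z = "(z, (z, b) \<notin> r \<or> (a, z) \<in> r)"
      have zG: "?z \<in> G" using z unfolding G_iff by blast
      have iff: "((x, l), ?z) \<in> ?D \<longleftrightarrow> (x, z) \<in> r" if "(x, l) \<in> G" for x l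
        using zG that trans[of x z b] trans[of a x z] unfolding D_pair G_iff by blast
      show ?thesis
        using H zG tuv z(2) iff[of o' h] iff[of p i] iff[of q j] unfolding t u v by blast
    qed
    obtain d where d: "d \<in> ?F" "(d, p) \<in> r" "(d, q) \<in> r"
      "\<And>z. z \<in> ?F \<Longrightarrow> (o', z) \<in> r \<Longrightarrow> (d, z) \<in> r \<Longrightarrow> (p, z) \<in> r"
    proof -
      have "join_sd r" using sd unfolding sd_lattice_def by blast
      note this[unfolded join_sd_def, rule_format, OF F base]
      then show thesis using that by blast
    qed
    obtain w where w: "w \<in> G" "\<forall>z\<in>G. (z, w) \<in> ?D \<longleftrightarrow> (z, u) \<in> ?D \<and> (z, v) \<in> ?D"
      using has_meets[unfolded has_meets_def FD, rule_format, OF tuv(2,3)] by blast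
    have self: "\<And>z. z \<in> G \<Longrightarrow> (z, z) \<in> ?D"
      unfolding D using refl by (auto simp: G_def)
    have uw: "(w, u) \<in> ?D" "(w, v) \<in> ?D" using w(2)[rule_format, OF w(1)] self[OF w(1)] by blast+
    have wd: "(d, fst w) \<in> r"
    proof -
      let ?d = "(d, (d, b) \<notin> r)"
      have dG: "?d \<in> G" using d(1) unfolding G_iff by blast
      then have "(?d, u) \<in> ?D \<and> (?d, v) \<in> ?D"
        using d(2,3) tuv trans[OF d(2), of b] trans[OF d(3), of b]
        unfolding D_pair u v G_iff by blast
      then have "(?d, w) \<in> ?D" using w dG by simp
      then show ?thesis unfolding D by simp
    qed
    have "(u, z) \<in> ?D" if z: "z \<in> G" "(t, z) \<in> ?D" "(w, z) \<in> ?D" for z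
    proof -
      obtain x l where x: "z = (x, l)" by (cases z)
      have xF: "x \<in> ?F" "(o', x) \<in> r" "h \<longrightarrow> l"
        using z unfolding x t D_pair G_iff by blast+
      have "(fst w, x) \<in> r" using z(3) by (simp add: x D)
      then have px: "(p, x) \<in> r" by (intro d(4) xF trans[OF wd])
      have qx: "(q, x) \<in> r" using px base[OF xF(1,2)] by simp
      \<comment> \<open>Dually, \<open>u\<close> and \<open>v\<close> are then both at level
        \<open>True\<close> and above \<open>a\<close>, so \<open>(a, True)\<close> is below
        \<open>w\<close> and hence below \<open>z\<close>, which is at level
        \<open>False\<close>.\<close>
      have l if i
      proof (rule ccontr)
        assume "\<not> l"
        then have "(x, b) \<in> r" using z(1) unfolding x G_iff by blast
        then have "(p, b) \<in> r" "(q, b) \<in> r" by (rule trans[OF px], rule trans[OF qx])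
        then have "(a, p) \<in> r" using tuv(2) \<open>i\<close> unfolding u G_iff by blast
        have "(v, z) \<notin> ?D"
          using H[rule_format, OF z(1,2)] \<open>\<not> l\<close> \<open>i\<close> by (simp add: x u D_pair)
        then have j
          using z(1) qx tuv(3) unfolding x v D_pair by blast
        then have "(a, q) \<in> r" using tuv(3) \<open>(q, b) \<in> r\<close> unfolding v G_iff by blast
        have "(a, True) \<in> G" using refl[OF aF] aF by (simp add: G_iff)
        then have "((a, True), w) \<in> ?D"
          using w(2) tuv \<open>(a, p) \<in> r\<close> \<open>(a, q) \<in> r\<close> \<open>i\<close> \<open>j\<close> unfolding u v
          by (simp add: D_pair)
        then show False using z(3) \<open>\<not> l\<close> by (simp add: D x)
      qed
      then show ?thesis using px z(1) tuv(2) unfolding x u D_pair by blast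
    qed
    then show "\<exists>d\<in>G. (d, u) \<in> ?D \<and> (d, v) \<in> ?D \<and>
        (\<forall>z\<in>G. (t, z) \<in> ?D \<and> (d, z) \<in> ?D \<longrightarrow> (u, z) \<in> ?D)"
      using w(1) uw by blast
  qed
  show ?thesis
    unfolding sd_lattice_def
  proof (intro conjI has_meets has_joins meet_sd join_sd)
    show "\<forall>x\<in>Field ?D. (x, x) \<in> ?D"
      unfolding FD D using refl by (auto simp: G_def)
    show "\<forall>x\<in>Field ?D. \<forall>y\<in>Field ?D. \<forall>z\<in>Field ?D.
        (x, y) \<in> ?D \<longrightarrow> (y, z) \<in> ?D \<longrightarrow> (x, z) \<in> ?D"
      unfolding D using trans by (metis (no_types))
  qed
qed

lemma sd_lattice_iterated_interval_doubling:
  "iterated_interval_doubling r \<Longrightarrow> sd_lattice r"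
proof (induction rule: iterated_interval_doubling.induct)
  case (one_element n)
  then show ?case
    by (simp add: sd_lattice_def has_meets_def has_joins_def meet_sd_def join_sd_def)
next
  case (double r a b s)
  then show ?case
    using sd_lattice_doubling[of r a b] sd_lattice_iso[of _ s] by blast
qed

lemma sd_lattice_congruence_uniform: "congruence_uniform r \<Longrightarrow> sd_lattice r"
  unfolding congruence_uniform_def
  using sd_lattice_iterated_interval_doubling sd_lattice_iso[of r] by blast

section \<open>Semidistributivity in terms of the lattice operations\<close>

lemma Field_relation_of_le [simp]: "Field (relation_of (\<le>) (UNIV :: 'a::order set)) = UNIV"
  by (auto simp: Field_def relation_of_def)

lemma relation_of_UNIV_iff [simp]: "(x, y) \<in> relation_of P UNIV \<longleftrightarrow> P x y"
  by (simp add: relation_of_def)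

lemma sd_lattice_imp_join_semidistributive:
  assumes sd: "sd_lattice (relation_of (\<le>) (UNIV :: 'a::lattice set))"
    and eq: "sup a b = sup a (c :: 'a)"
  shows "sup a (inf b c) = sup a b"
proof -
  have "b \<le> z \<longleftrightarrow> c \<le> z" if "a \<le> z" for z
    using le_sup_iff[of a b z] le_sup_iff[of a c z] that unfolding eq by blast
  moreover have "join_sd (relation_of (\<le>) (UNIV :: 'a set))"
    using sd unfolding sd_lattice_def by blast
  ultimately have "\<exists>d. d \<le> b \<and> d \<le> c \<and> (\<forall>z. a \<le> z \<and> d \<le> z \<longrightarrow> b \<le> z)"
    unfolding join_sd_def by simp
  then obtain d where d: "d \<le> b" "d \<le> c" "\<forall>z. a \<le> z \<and> d \<le> z \<longrightarrow> b \<le> z"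
    by blast
  have "d \<le> sup a (inf b c)"
    using d by (simp add: le_supI2)
  then have "b \<le> sup a (inf b c)"
    using d(3) by simp
  then show ?thesis
    by (simp add: antisym le_supI2)
qed

lemma sd_lattice_imp_meet_semidistributive:
  assumes sd: "sd_lattice (relation_of (\<le>) (UNIV :: 'a::lattice set))"
    and eq: "inf a b = inf a (c :: 'a)"
  shows "inf a (sup b c) = inf a b"
proof -
  have "z \<le> b \<longleftrightarrow> z \<le> c" if "z \<le> a" for z
    using le_inf_iff[of z a b] le_inf_iff[of z a c] that unfolding eq by blast
  moreover have "meet_sd (relation_of (\<le>) (UNIV :: 'a set))"
    using sd unfolding sd_lattice_def by blast
  ultimately have "\<exists>d. b \<le> d \<and> c \<le> d \<and> (\<forall>z. z \<le> a \<and> z \<le> d \<longrightarrow> z \<le> b)"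
    unfolding meet_sd_def by simp
  then obtain d where d: "b \<le> d" "c \<le> d" "\<forall>z. z \<le> a \<and> z \<le> d \<longrightarrow> z \<le> b"
    by blast
  have "inf a (sup b c) \<le> d"
    using d by (simp add: le_infI2)
  then have "inf a (sup b c) \<le> b"
    using d(3) by simp
  then show ?thesis
    by (simp add: antisym le_infI2)
qed

section \<open>Covers and join-irreducibles\<close>

lemma covered_byD:
  assumes "x \<lessdot> y"
  shows "x < y" and "x < z \<Longrightarrow> z \<le> y \<Longrightarrow> z = y"
  using assms unfolding covered_by_def by (auto simp: le_less)

lemma ex_lower_cover_above:
  fixes x y :: "'a::{finite, order}"
  assumes "x < y"
  shows "\<exists>z. x \<le> z \<and> z \<lessdot> y"
proof -
  obtain z where z: "z \<in> {z. x \<le> z \<and> z < y}" "\<forall>w\<in>{z. x \<le> z \<and> z < y}. z \<le> w \<longrightarrow> z = w"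
    using finite_has_maximal[of "{z. x \<le> z \<and> z < y}"] assms by auto
  have "\<not> (z < w \<and> w < y)" for w
    using z by (metis (mono_tags, lifting) less_imp_le less_irrefl mem_Collect_eq order.trans)
  then show ?thesis
    unfolding covered_by_def using z(1) by blast
qed

lemma ex_upper_cover_below:
  fixes x y :: "'a::{finite, order}"
  assumes "x < y"
  shows "\<exists>z. x \<lessdot> z \<and> z \<le> y"
proof -
  obtain z where z: "z \<in> {z. x < z \<and> z \<le> y}" "\<forall>w\<in>{z. x < z \<and> z \<le> y}. w \<le> z \<longrightarrow> z = w"
    using finite_has_minimal[of "{z. x < z \<and> z \<le> y}"] assms by auto
  have "\<not> (x < w \<and> w < z)" for w
    using z by (metis (mono_tags, lifting) less_imp_le less_irrefl mem_Collect_eq order.trans)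
  then show ?thesis
    unfolding covered_by_def using z(1) by blast
qed

lemma lower_covers_incomparable:
  fixes x y y' :: "'a::lattice"
  assumes "y \<lessdot> x" "y' \<lessdot> x" "y \<noteq> y'"
  shows "\<not> y' \<le> y"
  using assms by (metis covered_byD order.strict_iff_order)

text \<open>A join of finitely many elements strictly below \<open>j\<close> stays strictly below
  \<open>j\<close>; the empty join is covered by \<open>j \<noteq> bot\<close>. So the join of all
  elements strictly below \<open>j\<close> is the only lower cover.\<close>

lemma join_irreducible_lower_cover:
  fixes j :: "'a::{finite, complete_lattice}"
  assumes j: "join_irreducible j"
  shows lower_cover_covered: "lower_cover j \<lessdot> j"
    and le_lower_cover: "z < j \<Longrightarrow> z \<le> lower_cover j"
proof -
  have "Sup A < j" if "\<forall>z\<in>A. z < j" for A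
    using finite[of A] that
  proof (induction A rule: finite_induct)
    case empty
    then show ?case
      using j by (simp add: join_irreducible_def bot.not_eq_extremum)
  next
    case (insert z A)
    then have "z < j" "Sup A < j" by auto
    then have "sup z (Sup A) \<le> j" "j \<notin> {z, Sup A}" by auto
    then have "sup z (Sup A) < j"
      using j unfolding join_irreducible_def by (metis order.not_eq_order_implies_strict)
    then show ?case by simp
  qed
  then have lt: "Sup {z. z < j} < j" by simp
  have le: "z \<le> Sup {z. z < j}" if "z < j" for z
    using that by (simp add: Sup_upper)
  have cov: "Sup {z. z < j} \<lessdot> j"
    unfolding covered_by_def using lt le by (auto dest: leD)
  have eq: "lower_cover j = Sup {z. z < j}"
    unfolding lower_cover_def
  proof (rule the_equality)
    show "Sup {z. z < j} \<lessdot> j" by (rule cov)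
    fix i assume i: "i \<lessdot> j"
    then have "i \<le> Sup {z. z < j}" by (intro le covered_byD(1))
    moreover have "\<not> i < Sup {z. z < j}" using i lt unfolding covered_by_def by blast
    ultimately show "i = Sup {z. z < j}" by (simp add: less_le)
  qed
  show "lower_cover j \<lessdot> j" using cov eq by simp
  show "z < j \<Longrightarrow> z \<le> lower_cover j" using le eq by simp
qed

text \<open>A minimal element below \<open>a\<close> but not below \<open>t\<close> works: if it is
  a join, one of the two joinands is not below \<open>t\<close>, and minimality makes that one equal
  to it.\<close>

lemma ex_join_irreducible_separating:
  fixes a t :: "'a::{finite, complete_lattice}"
  assumes "\<not> a \<le> t"
  shows "\<exists>j. join_irreducible j \<and> j \<le> a \<and> \<not> j \<le> t"
proof -
  let ?S = "{j. j \<le> a \<and> \<not> j \<le> t}"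
  obtain j where j: "j \<in> ?S" "\<forall>z\<in>?S. z \<le> j \<longrightarrow> j = z"
    using finite_has_minimal[of ?S] assms by auto
  have "join_irreducible j"
    unfolding join_irreducible_def
  proof (intro conjI allI impI)
    show "j \<noteq> bot" using j by auto
    fix x y assume xy: "j = sup x y"
    then have "x \<le> j" "y \<le> j" by auto
    moreover have "\<not> x \<le> t \<or> \<not> y \<le> t" using j(1) xy by auto
    ultimately have "x \<in> ?S \<or> y \<in> ?S" using j(1) by auto
    then show "j \<in> {x, y}" using j(2) \<open>x \<le> j\<close> \<open>y \<le> j\<close> by auto
  qed
  then show ?thesis using j by auto
qed

lemma nucleus_le:
  fixes x :: "'a::{finite, complete_lattice}"
  assumes "y \<lessdot> x"
  shows "nucleus x \<le> y"
  using assms unfolding nucleus_def by (auto intro: Inf_lower)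

section \<open>Labels in join-semidistributive lattices\<close>

text \<open>The type token only serves to bind the type variable of the lattice.\<close>

locale join_semidistributive =
  fixes lattice_type :: "'a::{finite, complete_lattice} itself"
  assumes jsd: "sup a b = sup a (c :: 'a) \<Longrightarrow> sup a (inf b c) = sup a b"
begin

text \<open>Join-semidistributivity makes a minimal solution \<open>j\<close> of
  \<open>sup x z = y\<close> the least one, by comparing it with its meets with other solutions.
  Everything strictly below \<open>j\<close> then falls below \<open>x\<close>, which makes
  \<open>j\<close> join-irreducible with lower cover below \<open>x\<close>.\<close>

lemma cover_label_least:
  fixes x y :: 'a
  assumes xy: "x \<lessdot> y"
  shows "join_irreducible (cover_label x y) \<and> sup x (cover_label x y) = y \<and>
    lower_cover (cover_label x y) \<le> x \<and> (\<forall>z. sup x z = y \<longrightarrow> cover_label x y \<le> z)"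
proof -
  let ?S = "{z. sup x z = y}"
  have yS: "y \<in> ?S"
    using covered_byD(1)[OF xy] by (simp add: sup_absorb2)
  obtain j where j: "sup x j = y" and min: "\<And>z. z \<in> ?S \<Longrightarrow> z \<le> j \<Longrightarrow> j = z"
    using finite_has_minimal[of ?S] yS by auto
  have least: "j \<le> z" if z: "sup x z = y" for z
  proof -
    have "sup x (inf j z) = y" using jsd[of x j z] j z by simp
    then have "j = inf j z" using min by simp
    then show ?thesis by (metis inf_le2)
  qed
  have below: "w \<le> x" if "w < j" for w
  proof -
    have "sup x w \<noteq> y" using least[of w] that by auto
    moreover have "sup x w \<le> y" using j that by (metis less_imp_le sup_mono order_refl)
    ultimately show ?thesis
      using covered_byD(2)[OF xy] by (metis order.not_eq_order_implies_strict sup.cobounded1 sup.cobounded2)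
  qed
  have "\<not> j \<le> x" using j covered_byD(1)[OF xy] by (auto simp: sup_absorb1)
  have ji: "join_irreducible j"
    unfolding join_irreducible_def
  proof (intro conjI allI impI)
    show "j \<noteq> bot" using \<open>\<not> j \<le> x\<close> by auto
    fix u v assume uv: "j = sup u v"
    show "j \<in> {u, v}"
    proof (rule ccontr)
      assume "j \<notin> {u, v}"
      then have "u < j" "v < j"
        using uv by (auto simp: less_le)
      then show False using below uv \<open>\<not> j \<le> x\<close> by simp
    qed
  qed
  have jl: "lower_cover j \<le> x"
    using below lower_cover_covered[OF ji] covered_byD(1) by blast
  have "cover_label x y = j"
    unfolding cover_label_def
  proof (rule the_equality)
    have "inf j x = lower_cover j"
    proof (rule antisym)
      have "inf j x < j" using \<open>\<not> j \<le> x\<close> by (metis inf.cobounded1 inf.cobounded2 order.not_eq_order_implies_strict)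
      then show "inf j x \<le> lower_cover j" by (rule le_lower_cover[OF ji])
      show "lower_cover j \<le> inf j x"
        using jl covered_byD(1)[OF lower_cover_covered[OF ji]] by (simp add: less_imp_le)
    qed
    then show "join_irreducible j \<and> perspective (x, y) (lower_cover j, j)"
      using ji j by (simp add: perspective_def sup_commute)
  next
    fix k assume k: "join_irreducible k \<and> perspective (x, y) (lower_cover k, k)"
    then have klt: "lower_cover k < k"
      using lower_cover_covered covered_byD(1) by blast
    \<comment> \<open>The other orientation of perspectivity degenerates: join-irreducibility of
      \<open>k\<close> forces \<open>k = y\<close> and \<open>x = lower_cover k\<close>, and then
      this orientation holds too.\<close>
    have "sup k x = y \<and> inf k x = lower_cover k"
    proof (cases "sup k x = y \<and> inf k x = lower_cover k")
      case False
      then have "sup (lower_cover k) y = k" "inf (lower_cover k) y = x"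
        using k by (auto simp: perspective_def)
      then have "k \<in> {lower_cover k, y}"
        using k unfolding join_irreducible_def by metis
      then have "k = y" using klt by auto
      then have "x = lower_cover k"
        using \<open>inf (lower_cover k) y = x\<close> klt by (simp add: inf_absorb1)
      note \<open>k = y\<close> \<open>x = lower_cover k\<close>
      then show ?thesis using klt by (simp add: sup_absorb1 inf_absorb2 less_imp_le)
    qed auto
    then have "j \<le> k" "lower_cover k \<le> x"
      using least[of k] by (simp add: sup_commute, metis inf_le2)
    moreover have "\<not> j < k"
      using le_lower_cover[of k j] k \<open>\<not> j \<le> x\<close> \<open>lower_cover k \<le> x\<close> order.trans by blast
    ultimately show "k = j" by (simp add: less_le)
  qed
  then show ?thesis using ji j jl least by simp
qed

lemma cover_label:
  fixes x y :: 'a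
  assumes xy: "x \<lessdot> y"
  shows join_irreducible_cover_label: "join_irreducible (cover_label x y)"
    and lower_cover_label_le: "lower_cover (cover_label x y) \<le> x"
    and sup_cover_label: "sup x (cover_label x y) = y"
    and cover_label_le: "cover_label x y \<le> y"
    and cover_label_not_le: "\<not> cover_label x y \<le> x"
    and cover_label_minimal: "z \<le> y \<Longrightarrow> \<not> z \<le> x \<Longrightarrow> cover_label x y \<le> z"
proof -
  note L = cover_label_least[OF xy]
  show "join_irreducible (cover_label x y)" "lower_cover (cover_label x y) \<le> x"
    "sup x (cover_label x y) = y"
    using L by auto
  then show "cover_label x y \<le> y" by (metis sup.cobounded2)
  show "\<not> cover_label x y \<le> x"
    using L covered_byD(1)[OF xy] by (auto simp: sup_absorb1)
  show "cover_label x y \<le> z" if "z \<le> y" "\<not> z \<le> x"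
  proof -
    have "x < sup x z" using that by (metis less_le sup.cobounded1 sup.cobounded2)
    moreover have "sup x z \<le> y" using that covered_byD(1)[OF xy] by simp
    ultimately have "sup x z = y" using covered_byD(2)[OF xy] by blast
    then show ?thesis using L by blast
  qed
qed

section \<open>Canonical joinands as labels of lower covers\<close>

lemma cover_label_le_other:
  fixes x :: 'a
  assumes "y \<lessdot> x" "y' \<lessdot> x" "y \<noteq> y'"
  shows "cover_label y x \<le> y'"
  using cover_label_minimal[OF assms(1)] lower_covers_incomparable[OF assms] covered_byD(1)[OF assms(2)]
  by (simp add: less_imp_le)

text \<open>If \<open>y\<close> and \<open>y'\<close> differ, the label of \<open>y'\<close> lies
  below \<open>y\<close>, whereas the label of \<open>y\<close> does not.\<close>

lemma cover_labels_antichain: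
  fixes x :: 'a
  assumes "y \<lessdot> x" "y' \<lessdot> x" "cover_label y x \<le> cover_label y' x"
  shows "y = y'"
  using assms cover_label_le_other[of y' x y] cover_label_not_le[OF assms(1)] order.trans by blast

text \<open>A smaller join would lie below some lower cover \<open>y\<close>, and with it the label
  of \<open>y \<lessdot> x\<close>, which is never below \<open>y\<close>.\<close>

lemma Sup_cover_labels: "Sup {cover_label y x | y. y \<lessdot> x} = (x :: 'a)" (is "Sup ?X = x")
proof (rule ccontr)
  assume "Sup ?X \<noteq> x"
  moreover have "Sup ?X \<le> x"
    by (rule Sup_least) (auto intro: cover_label_le)
  ultimately have "Sup ?X < x" by (rule order.not_eq_order_implies_strict)
  then obtain y where y: "Sup ?X \<le> y" "y \<lessdot> x"
    using ex_lower_cover_above by blast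
  have "cover_label y x \<le> Sup ?X"
    using y by (intro Sup_upper) auto
  then show False
    using order.trans[OF _ y(1)] cover_label_not_le[OF y(2)] by blast
qed

lemma cover_label_le_joinand:
  fixes x :: 'a
  assumes "y \<lessdot> x" "Sup Y = x"
  shows "\<exists>b\<in>Y. cover_label y x \<le> b"
proof -
  have "\<not> Sup Y \<le> y"
    using assms(2) covered_byD(1)[OF assms(1)] by (simp add: less_le_not_le)
  then obtain b where b: "b \<in> Y" "\<not> b \<le> y"
    using Sup_least[of Y y] by blast
  moreover have "b \<le> x" using Sup_upper[OF b(1)] assms(2) by simp
  ultimately show ?thesis
    using cover_label_minimal[OF assms(1)] by blast
qed

text \<open>Every join representation of \<open>x\<close> has a member not below \<open>y\<close>,
  hence one above the label of \<open>y \<lessdot> x\<close>; irredundancy follows because the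
  labels form an antichain. For uniqueness, refinement in both directions puts the labels into any
  other canonical representation, whose irredundancy leaves room for nothing more.\<close>

lemma canonical_joinands_eq:
  "canonical_joinands (x :: 'a) = {cover_label y x | y. y \<lessdot> x}" (is "_ = ?X")
  unfolding canonical_joinands_def
proof (rule the_equality)
  show "canonical_join_representation ?X x"
    unfolding canonical_join_representation_def join_representation_def
  proof (intro conjI allI impI ballI)
    show "Sup ?X = x" by (rule Sup_cover_labels)
    show "Sup Z \<noteq> x" if "Z \<subset> ?X" for Z
    proof
      assume "Sup Z = x"
      have "?X \<subseteq> Z"
      proof
        fix a assume "a \<in> ?X"
        then obtain y where y: "y \<lessdot> x" "a = cover_label y x" by blast
        obtain b where b: "b \<in> Z" "a \<le> b"
          using cover_label_le_joinand[OF y(1) \<open>Sup Z = x\<close>] y by blast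
        then obtain y' where "y' \<lessdot> x" "b = cover_label y' x" using \<open>Z \<subset> ?X\<close> by blast
        then show "a \<in> Z" using b y cover_labels_antichain[of y x y'] by simp
      qed
      then show False using \<open>Z \<subset> ?X\<close> by blast
    qed
    show "\<exists>b\<in>Y. a \<le> b" if Y: "Sup Y = x" and a: "a \<in> ?X" for Y a
    proof -
      obtain y where "y \<lessdot> x" "a = cover_label y x" using a by blast
      then show ?thesis using cover_label_le_joinand[OF _ Y] by simp
    qed
  qed
next
  fix Y assume "canonical_join_representation Y x"
  then have Y: "Sup Y = x" "\<And>Z. Z \<subset> Y \<Longrightarrow> Sup Z \<noteq> x"
    "\<And>Z a. Sup Z = x \<Longrightarrow> a \<in> Y \<Longrightarrow> \<exists>b\<in>Z. a \<le> b"
    unfolding canonical_join_representation_def join_representation_def by auto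
  have "?X \<subseteq> Y"
  proof
    fix a assume "a \<in> ?X"
    then obtain y where y: "y \<lessdot> x" "a = cover_label y x" by blast
    obtain b where b: "b \<in> Y" "a \<le> b"
      using cover_label_le_joinand[OF y(1) Y(1)] y(2) by blast
    obtain c where c: "c \<in> ?X" "b \<le> c"
      using Y(3)[OF Sup_cover_labels b(1)] by blast
    then obtain y' where "y' \<lessdot> x" "c = cover_label y' x" by blast
    then have "a = c"
      using y cover_labels_antichain[of y x y'] order.trans[OF b(2) c(2)] by simp
    then show "a \<in> Y" using b c by (simp add: order.antisym)
  qed
  then show "Y = ?X"
    using Y(2)[of ?X] Sup_cover_labels[of x] by blast
qed

section \<open>Comparing core label sets with canonical joinands\<close>

lemma canonical_joinands_subset_core: "canonical_joinands (x :: 'a) \<subseteq> core_label_set x"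
  unfolding canonical_joinands_eq core_label_set_def using nucleus_le by blast

lemma Sup_core_label_set: "Sup (core_label_set x) = (x :: 'a)"
proof (rule antisym)
  show "Sup (core_label_set x) \<le> x"
    unfolding core_label_set_def by (rule Sup_least) (auto dest!: cover_label_le)
  show "x \<le> Sup (core_label_set x)"
    using Sup_subset_mono[OF canonical_joinands_subset_core[of x]] Sup_cover_labels[of x]
    by (simp add: canonical_joinands_eq)
qed

text \<open>Both kinds of sets determine their index as their join, so equality of the families is
  equality at every index.\<close>

lemma range_core_eq_iff:
  "range core_label_set = range (canonical_joinands :: 'a \<Rightarrow> 'a set) \<longleftrightarrow>
    (\<forall>x :: 'a. core_label_set x = canonical_joinands x)"
proof
  assume eq: "range core_label_set = range (canonical_joinands :: 'a \<Rightarrow> 'a set)"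
  show "\<forall>x :: 'a. core_label_set x = canonical_joinands x"
  proof
    fix x :: 'a
    obtain y where y: "core_label_set x = canonical_joinands y" using eq by blast
    then have "x = y"
      using Sup_core_label_set[of x] Sup_cover_labels[of y] by (simp add: canonical_joinands_eq)
    then show "core_label_set x = canonical_joinands x" using y by simp
  qed
qed (auto intro: image_cong)

lemma core_label_set_distributive:
  assumes dist: "\<And>x y z :: 'a. inf x (sup y z) = sup (inf x y) (inf x z)"
  shows "core_label_set (x :: 'a) = canonical_joinands x"
proof
  show "core_label_set x \<subseteq> canonical_joinands x"
  proof
    fix j assume "j \<in> core_label_set x"
    then obtain u v where uv: "nucleus x \<le> u" "u \<lessdot> v" "v \<le> x" and j: "j = cover_label u v"
      unfolding core_label_set_def by blast
    have jx: "j \<le> x" using cover_label_le[OF uv(2)] uv(3) j by simp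
    have "\<not> j \<le> nucleus x" using cover_label_not_le[OF uv(2)] order.trans[OF _ uv(1)] j by blast
    then obtain y where y: "y \<lessdot> x" "\<not> j \<le> y"
      using jx Inf_greatest[of "{y. y \<lessdot> x}" j] unfolding nucleus_def by (auto split: if_splits)
    let ?k = "cover_label y x"
    have "?k \<le> j" by (rule cover_label_minimal[OF y(1) jx y(2)])
    \<comment> \<open>Distributing \<open>j\<close> over \<open>x = sup y ?k\<close> splits it into
      \<open>inf j y\<close> and \<open>?k\<close>. Join-irreducibility selects one of them, and the
      first would put \<open>j\<close> below \<open>y\<close>.\<close>
    have "j = inf j (sup y ?k)" using jx sup_cover_label[OF y(1)] by (simp add: inf_absorb1)
    also have "\<dots> = sup (inf j y) ?k" using \<open>?k \<le> j\<close> by (simp add: dist inf_absorb2)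
    finally have "j \<in> {inf j y, ?k}"
      using join_irreducible_cover_label[OF uv(2)] unfolding j[symmetric] join_irreducible_def
      by (elim conjE allE impE)
    then have "j = ?k" using y(2) by (auto simp: inf.absorb_iff1)
    then show "j \<in> canonical_joinands x" using y unfolding canonical_joinands_eq by blast
  qed
qed (rule canonical_joinands_subset_core)

section \<open>Lattices whose core label sets are the canonical joinands\<close>

context
  assumes core: "\<And>x :: 'a. core_label_set x = canonical_joinands x"
begin

text \<open>A label occurring in the interval from \<open>inf y1 y2\<close> to \<open>y1\<close> belongs to some lower cover of \<open>x\<close>.
  It lies below \<open>y1\<close>, and the label of any lower cover other than \<open>y1\<close>, \<open>y2\<close> lies below
  \<open>inf y1 y2\<close>.\<close>

lemma label_in_diamond:
  fixes x :: 'a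
  assumes y: "y1 \<lessdot> x" "y2 \<lessdot> x" and uv: "inf y1 y2 \<le> u" "u \<lessdot> v" "v \<le> y1"
  shows "cover_label u v = cover_label y2 x"
proof -
  have "nucleus x \<le> u"
    using nucleus_le[OF y(1)] nucleus_le[OF y(2)] uv(1) by (meson le_inf_iff order.trans)
  moreover have "v \<le> x"
    using uv(3) covered_byD(1)[OF y(1)] by simp
  ultimately have "cover_label u v \<in> canonical_joinands x"
    using uv(2) unfolding core[symmetric] core_label_set_def by blast
  then obtain y where y': "y \<lessdot> x" "cover_label u v = cover_label y x"
    unfolding canonical_joinands_eq by blast
  have le: "cover_label y x \<le> y1"
    using cover_label_le[OF uv(2)] uv(3) y' by simp
  have "\<not> cover_label y x \<le> inf y1 y2"
    using cover_label_not_le[OF uv(2)] uv(1) y' order.trans by metis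
  then have "y = y2"
    using le cover_label_le_other[OF y'(1) y(2)] by auto
  then show ?thesis using y' by simp
qed

text \<open>All covers between \<open>inf y1 y2\<close> and \<open>y1\<close> carry one label. Two
  consecutive covers \<open>w \<lessdot> u \<lessdot> y1\<close> cannot share it, since the label of
  the first is below \<open>u\<close> and that of the second is not; so there is room for a single
  cover only.\<close>

lemma diamond:
  fixes x :: 'a
  assumes y: "y1 \<lessdot> x" "y2 \<lessdot> x" "y1 \<noteq> y2"
  shows "inf y1 y2 \<lessdot> y1" and "cover_label (inf y1 y2) y1 = cover_label y2 x"
proof -
  have "inf y1 y2 < y1"
    using lower_covers_incomparable[of y2 x y1] y by (metis inf.cobounded1 inf.cobounded2 less_le)
  then obtain u where u: "inf y1 y2 \<le> u" "u \<lessdot> y1"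
    using ex_lower_cover_above by blast
  have "u = inf y1 y2"
  proof (rule ccontr)
    assume "u \<noteq> inf y1 y2"
    then have "inf y1 y2 < u" using u(1) by (simp add: less_le)
    then obtain w where w: "inf y1 y2 \<le> w" "w \<lessdot> u"
      using ex_lower_cover_above by blast
    have "cover_label w u = cover_label u y1"
      using label_in_diamond[OF y(1,2)] u w covered_byD(1)[OF u(2)] by (simp add: less_imp_le)
    then show False
      using cover_label_le[OF w(2)] cover_label_not_le[OF u(2)] by simp
  qed
  then show c: "inf y1 y2 \<lessdot> y1" using u by simp
  show "cover_label (inf y1 y2) y1 = cover_label y2 x"
    by (rule label_in_diamond[OF y(1,2) order_refl c order_refl])
qed

text \<open>Induction on the number of elements below \<open>v\<close>. If
  \<open>j \<noteq> v\<close>, some lower cover \<open>y\<close> of \<open>v\<close> lies above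
  \<open>j\<close>, and the opposite side \<open>inf y u \<lessdot> y\<close> of the diamond carries
  the same label and still separates \<open>j\<close>.\<close>

lemma new_join_irreducible_unique:
  fixes u v j :: 'a
  assumes "u \<lessdot> v" "join_irreducible j" "j \<le> v" "\<not> j \<le> u"
  shows "j = cover_label u v"
  using assms
proof (induction "card {..<v}" arbitrary: u v rule: less_induct)
  case less
  note uv = less.prems(1) and j = less.prems(2-)
  show ?case
  proof (cases "j = v")
    case True
    have "cover_label u v \<le> j"
      by (rule cover_label_minimal[OF uv j(2,3)])
    \<comment> \<open>Here \<open>u\<close> is the lower cover of \<open>j = v\<close>, so a label
      strictly below \<open>j\<close> would be below \<open>u\<close>.\<close>
    moreover have "\<not> cover_label u v < j"
    proof
      assume "cover_label u v < j"
      then have "cover_label u v \<le> lower_cover j" by (rule le_lower_cover[OF j(1)])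
      moreover have "u \<le> lower_cover j"
        using le_lower_cover[OF j(1)] covered_byD(1)[OF uv] True by simp
      moreover have "\<not> u < lower_cover j"
        using uv covered_byD(1)[OF lower_cover_covered[OF j(1)]] True
        unfolding covered_by_def by blast
      ultimately show False using cover_label_not_le[OF uv] by (simp add: less_le)
    qed
    ultimately show ?thesis by (simp add: less_le)
  next
    case False
    then have "j < v" using j(2) by (simp add: less_le)
    then obtain y where y: "j \<le> y" "y \<lessdot> v"
      using ex_lower_cover_above by blast
    have ne: "y \<noteq> u" using j(3) y(1) by blast
    have "{..<y} \<subset> {..<v}" using covered_byD(1)[OF y(2)] by auto
    then have "card {..<y} < card {..<v}" by (simp add: psubset_card_mono)
    then have "j = cover_label (inf y u) y"
      using less.hyps[OF _ diamond(1)[OF y(2) uv ne] j(1) y(1)] j(3) by simp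
    then show ?thesis using diamond(2)[OF y(2) uv ne] by simp
  qed
qed

text \<open>Otherwise climb from \<open>z\<close> to a maximal \<open>u\<close> below the join but
  not above \<open>j\<close>. The next cover \<open>u \<lessdot> v\<close> inside the interval has
  label \<open>j\<close>, so \<open>lower_cover j\<close> is below \<open>u\<close>, and then the
  whole join is below \<open>u\<close>.\<close>

lemma le_sup_lower_coverD:
  fixes j z :: 'a
  assumes j: "join_irreducible j" and le: "j \<le> sup z (lower_cover j)"
  shows "j \<le> z"
proof (rule ccontr)
  assume nle: "\<not> j \<le> z"
  let ?x = "sup z (lower_cover j)"
  let ?S = "{u. z \<le> u \<and> u \<le> ?x \<and> \<not> j \<le> u}"
  have "z \<in> ?S" using nle by simp
  then have "?S \<noteq> {}" by blast
  then obtain u where u: "u \<in> ?S" and max: "\<forall>w\<in>?S. u \<le> w \<longrightarrow> u = w"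
    using finite_has_maximal[OF finite] by meson
  have "u < ?x" using u le by (auto simp: less_le)
  then obtain v where v: "u \<lessdot> v" "v \<le> ?x" using ex_upper_cover_below by blast
  have "u < v" by (rule covered_byD(1)[OF v(1)])
  then have "v \<notin> ?S" using max by (auto simp: less_le)
  moreover have "z \<le> v" using u \<open>u < v\<close> by auto
  ultimately have "j \<le> v" using v(2) by simp
  then have "j = cover_label u v"
    using new_join_irreducible_unique[OF v(1) j] u by simp
  then have "?x \<le> u" using lower_cover_label_le[OF v(1)] u by simp
  then show False using \<open>u < ?x\<close> leD by blast
qed

text \<open>It suffices that join-irreducibles are join-prime, since a failure of distributivity is
  detected by a separating join-irreducible.\<close>

lemma distributive_if_core_canonical:
  fixes x y z :: 'a
  assumes msd: "\<And>a b c :: 'a. inf a b = inf a c \<Longrightarrow> inf a (sup b c) = inf a b"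
  shows "inf x (sup y z) = sup (inf x y) (inf x z)"
proof (rule antisym)
  have prime: "j \<le> a \<or> j \<le> b" if j: "join_irreducible j" and ab: "j \<le> sup a b" for j a b :: 'a
  proof (rule ccontr)
    let ?i = "lower_cover j"
    assume "\<not> (j \<le> a \<or> j \<le> b)"
    \<comment> \<open>Enlarging \<open>a\<close> and \<open>b\<close> by the lower cover
      \<open>?i\<close> keeps them from lying above \<open>j\<close> and makes both meets with
      \<open>j\<close> equal to \<open>?i\<close>, as meet-semidistributivity requires.\<close>
    then have "\<not> j \<le> sup a ?i" "\<not> j \<le> sup b ?i"
      using le_sup_lower_coverD[OF j] by blast+
    moreover have "?i < j" by (rule covered_byD(1)[OF lower_cover_covered[OF j]])
    moreover have "inf j w = ?i" if "?i \<le> w" "\<not> j \<le> w" for w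
    proof (rule antisym)
      have "inf j w < j" using that by (metis inf.cobounded1 inf.cobounded2 less_le)
      then show "inf j w \<le> ?i" by (rule le_lower_cover[OF j])
      show "?i \<le> inf j w" using that \<open>?i < j\<close> by simp
    qed
    ultimately have "inf j (sup a ?i) = ?i" "inf j (sup b ?i) = ?i" by auto
    then have "inf j (sup (sup a ?i) (sup b ?i)) = ?i" using msd[of j "sup a ?i" "sup b ?i"] by simp
    moreover have "j \<le> sup (sup a ?i) (sup b ?i)"
      using ab by (rule order.trans) (simp add: le_supI1 le_supI2)
    ultimately show False using \<open>?i < j\<close> by (simp add: inf_absorb1)
  qed
  show "inf x (sup y z) \<le> sup (inf x y) (inf x z)"
  proof (rule ccontr)
    assume "\<not> ?thesis"
    then obtain j where j: "join_irreducible j" "j \<le> inf x (sup y z)"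
      "\<not> j \<le> sup (inf x y) (inf x z)"
      using ex_join_irreducible_separating by blast
    then have "j \<le> x" "j \<le> y \<or> j \<le> z" using prime by auto
    then show False using j(3) by (auto intro: le_supI1 le_supI2)
  qed
  show "sup (inf x y) (inf x z) \<le> inf x (sup y z)"
    by (simp add: le_infI2)
qed

end

end

section \<open>From orders to families of sets, and the equivalence\<close>

lemma relation_of_subset_eq_iff: "relation_of (\<subseteq>) A = relation_of (\<subseteq>) B \<longleftrightarrow> A = B"
proof
  \<comment> \<open>Inclusion is reflexive, so the order remembers its ground set.\<close>
  have "Field (relation_of (\<subseteq>) C) = C" for C :: "'a set set"
    by (auto simp: Field_def relation_of_def)
  then show "relation_of (\<subseteq>) A = relation_of (\<subseteq>) B \<Longrightarrow> A = B" by metis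
qed simp

theorem theorem1p1:
  assumes "congruence_uniform (relation_of (\<le>) (UNIV :: 'a::{finite, complete_lattice} set))"
  shows "(\<forall>x y z :: 'a. inf x (sup y z) = sup (inf x y) (inf x z)) \<longleftrightarrow>
    (core_label_order :: 'a set rel) = face_poset canonical_join_complex"
proof -
  note sd = sd_lattice_congruence_uniform[OF assms]
  interpret join_semidistributive "TYPE('a)"
    by unfold_locales (rule sd_lattice_imp_join_semidistributive[OF sd])
  have "(core_label_order :: 'a set rel) = face_poset canonical_join_complex \<longleftrightarrow>
      (\<forall>x :: 'a. core_label_set x = canonical_joinands x)"
    unfolding core_label_order_def face_poset_def canonical_join_complex_def
      relation_of_subset_eq_iff range_core_eq_iff ..
  moreover have "(\<forall>x y z :: 'a. inf x (sup y z) = sup (inf x y) (inf x z)) \<longleftrightarrow>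
      (\<forall>x :: 'a. core_label_set x = canonical_joinands x)"
    using core_label_set_distributive
      distributive_if_core_canonical[OF _ sd_lattice_imp_meet_semidistributive[OF sd]]
    by blast
  ultimately show ?thesis by simp
qed

end
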